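(* Let $D=(V,A)$ be a vertebrate directed acyclic graph. Then the acyclic reorientation poset $\mathcal{AR}_D$ is a lattice, where the join (resp. meet) of a set of acyclic reorientations $E_1,\dots,E_k$ of $D$ is the reorientation obtained from $D$ by reversing all arcs of $A$ that belong (resp. do not belong) to the transitive closure of the set of arcs of $D$ that are reversed (resp. not reversed) in at least one of the reorientations $E_1,\dots,E_k$.
   Context: All directed graphs are finite and simple. A reorientation of a directed acyclic graph $D=(V,A)$ is a directed graph with the same underlying undirected graph, encoded by the set of arcs of $D$ that it reverses. $\mathcal{AR}_D$ is the poset of acyclic reorientations of $D$ ordered by inclusion of sets of reversed arcs. The transitive reduction of a directed acyclic graph is obtained by deleting all arcs whose endpoints are connected by a directed path of length at least $2$. A directed graph is a forest if its underlying undirected graph has no cycle. $D$ is vertebrate if the transitive reduction of every induced subgraph of $D$ is a forest. The transitive closure of a set $B\subseteq A$ of arcs of $D$ is the set of pairs $(u,v)$ such that there is a directed path of length at least $1$ from $u$ to $v$ formed by arcs of $B$ (arcs taken with their orientation in $D$). *)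

theory Defs
  imports "Graph_Theory.Digraph_Component" "HOL-Algebra.Lattice"
begin

definition transitive_reduction :: "('a, 'b) pre_digraph \<Rightarrow> ('a, 'b) pre_digraph" where
  "transitive_reduction G = G\<lparr>arcs := {e \<in> arcs G.
     \<not> (\<exists>p. pre_digraph.apath G (tail G e) p (head G e) \<and> length p \<ge> 2)}\<rparr>"

text \<open>
  The underlying undirected graph is the symmetric digraph \<open>mk_symmetric G\<close>, in which every
  edge \<open>{u, v}\<close> yields a directed cycle \<open>u, v, u\<close> of length 2 (and a loop one of length 1).
  The cycles of a simple undirected graph are the directed cycles of length at least 3.
  The library constant \<open>forest\<close> rules out all directed cycles, so it expresses something else.
\<close>
definition undirected_forest :: "('a, 'b) pre_digraph \<Rightarrow> bool" where
  "undirected_forest G \<longleftrightarrow>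
     \<not> (\<exists>p. pre_digraph.cycle (with_proj (mk_symmetric G)) p \<and> length p \<ge> 3)"

definition vertebrate :: "'a pair_pre_digraph \<Rightarrow> bool" where
  "vertebrate D \<longleftrightarrow>
     (\<forall>W \<subseteq> pverts D. undirected_forest (transitive_reduction (with_proj D \<restriction> W)))"

definition reorient :: "'a pair_pre_digraph \<Rightarrow> 'a rel \<Rightarrow> 'a pair_pre_digraph" where
  "reorient D R = D\<lparr>parcs := (parcs D - R) \<union> R\<inverse>\<rparr>"

definition acyclic_reorientations :: "'a pair_pre_digraph \<Rightarrow> 'a rel set" where
  "acyclic_reorientations D = {R. R \<subseteq> parcs D \<and> acyclic (parcs (reorient D R))}"

definition AR :: "'a pair_pre_digraph \<Rightarrow> 'a rel gorder" where
  "AR D = \<lparr>carrier = acyclic_reorientations D, eq = (=), le = (\<subseteq>)\<rparr>"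

end

theory Submission
  imports Defs
begin

text \<open>
  Write \<open>A\<close> for the arcs of \<open>D\<close>. A set \<open>R \<subseteq> A\<close> is an acyclic reorientation iff both \<open>R\<close> and
  \<open>A - R\<close> are transitively closed within \<open>A\<close>: otherwise a shortest cycle of the reorientation is
  chordless, and by the forest condition on its vertex set it consists of one arc and a parallel
  directed path of \<open>D\<close>, oppositely reoriented, against closedness.
  Let \<open>B\<close> be a union of acyclic reorientations, \<open>R = A \<inter> B\<^sup>+\<close> and \<open>Y = A - R\<close>. The set \<open>Y\<close> is closed
  because no \<open>B\<close>-path is parallel to a \<open>Y\<close>-path: take such a pair with last possible source.
  By the forest condition its vertices form a chain. Going up this chain from the source, the
  first switch from one path to the other is an arc of \<open>A\<close>; whether it lies in \<open>R\<close> or \<open>Y\<close>, it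
  either contradicts closedness or yields such a pair with a later source.
  Meets reduce to joins by the complementation \<open>R \<mapsto> A - R\<close>, which reverses all arcs.
\<close>

section \<open>Covers, bridges and intervals\<close>

text \<open>For acyclic \<open>Z\<close> this is the transitive reduction:
  \<open>Z O Z\<^sup>+\<close> consists of the pairs joined by a path of length at least 2.\<close>

definition covers :: "'a rel \<Rightarrow> 'a rel" where
  "covers Z = Z - Z O Z\<^sup>+"

text \<open>For irreflexive \<open>H\<close> this is the forest condition edge by edge: an edge lies
  on no cycle iff deleting it separates its end points. In this form any undirected walk refutes it,
  simple or not.\<close>

definition all_bridges :: "'a rel \<Rightarrow> bool" where
  "all_bridges H \<longleftrightarrow> (\<forall>(x, y) \<in> H. (x, y) \<notin> (H \<union> H\<inverse> - {(x, y), (y, x)})\<^sup>*)"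

lemma covers_subset: "covers Z \<subseteq> Z"
  by (auto simp: covers_def)

lemma all_bridgesD:
  assumes "all_bridges H" and "(x, y) \<in> H \<union> H\<inverse>"
  shows "(x, y) \<notin> (H \<union> H\<inverse> - {(x, y), (y, x)})\<^sup>*"
proof -
  let ?S = "\<lambda>x y. H \<union> H\<inverse> - {(x, y), (y, x)}"
  have "sym ((?S x y)\<^sup>*)"
    by (rule sym_rtrancl) (auto intro!: symI)
  moreover have "?S y x = ?S x y" by auto
  moreover have "(x, y) \<notin> (?S x y)\<^sup>* \<or> (y, x) \<notin> (?S y x)\<^sup>*"
    using assms unfolding all_bridges_def by blast
  ultimately show ?thesis
    by (metis symD)
qed

text \<open>Serves to confine a path: to place it in a vertex set or keep it off an arc, only arcs
  between its end points need checking.\<close>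

lemma rtrancl_restrict_interval:
  assumes "(x, y) \<in> r\<^sup>*"
  shows "(x, y) \<in> {(s, t) \<in> r. (x, s) \<in> r\<^sup>* \<and> (t, y) \<in> r\<^sup>*}\<^sup>*"
  using assms
proof (induction rule: converse_rtrancl_induct)
  case (step x z)
  let ?r = "\<lambda>x. {(s, t) \<in> r. (x, s) \<in> r\<^sup>* \<and> (t, y) \<in> r\<^sup>*}"
  have "(x, z) \<in> ?r x" using step.hyps by auto
  moreover have "?r z \<subseteq> ?r x"
    using step.hyps(1) by (auto intro: converse_rtrancl_into_rtrancl)
  ultimately show ?case
    using step.IH rtrancl_mono[of "?r z" "?r x"] by (meson converse_rtrancl_into_rtrancl subsetD)
qed simp

text \<open>Induction on the number of vertices strictly between \<open>u\<close> and
  \<open>v\<close>: a pair that is no cover splits at some \<open>w\<close>, and by acyclicity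
  \<open>w\<close> itself is missing from both smaller intervals.\<close>

lemma trancl_covers:
  assumes "finite Z" "acyclic Z"
  shows "(covers Z)\<^sup>+ = Z\<^sup>+"
proof
  show "(covers Z)\<^sup>+ \<subseteq> Z\<^sup>+" by (simp add: covers_subset trancl_mono_subset)
  have "(u, v) \<in> (covers Z)\<^sup>+" if "(u, v) \<in> Z\<^sup>+" for u v
    using that
  proof (induction "card {x. (u, x) \<in> Z\<^sup>+ \<and> (x, v) \<in> Z\<^sup>+}" arbitrary: u v rule: less_induct)
    case less
    let ?I = "\<lambda>u v. {x. (u, x) \<in> Z\<^sup>+ \<and> (x, v) \<in> Z\<^sup>+}"
    show ?case
    proof (cases "(u, v) \<in> covers Z")
      case False
      obtain w where w: "(u, w) \<in> Z\<^sup>+" "(w, v) \<in> Z\<^sup>+"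
      proof (cases "(u, v) \<in> Z")
        case True
        then show ?thesis using False that by (auto simp: covers_def)
      next
        case False
        then show ?thesis using less.prems that by (blast elim: tranclE)
      qed
      have fin: "finite (?I u v)"
        by (rule finite_subset[of _ "Range Z"]) (auto simp: assms finite_Range dest: tranclD2)
      have nw: "(w, w) \<notin> Z\<^sup>+" using assms(2) by (auto simp: acyclic_def)
      have "?I u w \<subset> ?I u v" "?I w v \<subset> ?I u v"
        using w nw by (auto intro: trancl_trans)
      then show ?thesis
        using less.hyps w fin by (meson psubset_card_mono trancl_trans)
    qed auto
  qed
  then show "Z\<^sup>+ \<subseteq> (covers Z)\<^sup>+" by auto
qed

text \<open>If \<open>u \<rightarrow> u'\<close> starts a path to \<open>a\<close> and \<open>u'\<close> is not below \<open>b\<close>, then the undirected walk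
  \<open>u' \<dots> a \<dots> v \<dots> b \<dots> u\<close> avoids the arc \<open>u \<rightarrow> u'\<close>, which is therefore no bridge.\<close>
lemma all_bridges_interval_chain:
  assumes fin: "finite H" and ac: "acyclic H" and br: "all_bridges H"
    and "(u, a) \<in> H\<^sup>*" "(u, b) \<in> H\<^sup>*" and av: "(a, v) \<in> H\<^sup>*" and bv: "(b, v) \<in> H\<^sup>*"
  shows "(a, b) \<in> H\<^sup>* \<or> (b, a) \<in> H\<^sup>*"
  using assms(4,5)
proof (induction u rule: wf_induct_rule[OF finite_acyclic_wf_converse[OF fin ac]])
  case (1 u)
  show ?case
  proof (cases "u = a \<or> u = b")
    case False
    obtain u' where u': "(u, u') \<in> H" "(u', a) \<in> H\<^sup>*"
      using 1(2) False by (meson converse_rtranclE)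
    show ?thesis
    proof (cases "(u', b) \<in> H\<^sup>*")
      case True
      then show ?thesis using 1(1)[of u'] u' by auto
    next
      case nb: False
      let ?T = "H \<union> H\<inverse> - {(u, u'), (u', u)}"
      have above: "(t, u) \<notin> H\<^sup>*" if "(u, t) \<in> H\<^sup>+" for t
        using that ac by (meson acyclic_def rtrancl_trancl_trancl trancl_rtrancl_trancl)
      have ub: "(u, b) \<in> H\<^sup>+" using 1(3) False by (auto simp: rtrancl_eq_or_trancl)
      \<comment> \<open>Paths starting strictly above \<open>u\<close> never return to
        \<open>u\<close>, so they cannot use the deleted edge.\<close>
      have up: "(x, y) \<in> ?T\<^sup>*" if "(x, y) \<in> H\<^sup>*" "(u, x) \<in> H\<^sup>+" for x y
      proof -
        have "{(s, t) \<in> H. (x, s) \<in> H\<^sup>* \<and> (t, y) \<in> H\<^sup>*} \<subseteq> ?T"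
        proof clarify
          fix s t assume st: "(s, t) \<in> H" "(x, s) \<in> H\<^sup>*"
          then have "(u, s) \<in> H\<^sup>+" "(u, t) \<in> H\<^sup>+" using that by auto
          then have "s \<noteq> u" "t \<noteq> u" using above by blast+
          then show "(s, t) \<in> ?T" using st by auto
        qed
        then show ?thesis using rtrancl_restrict_interval[OF that(1)] rtrancl_mono by blast
      qed
      \<comment> \<open>Every vertex on a path to \<open>b\<close> reaches \<open>b\<close>, but
        \<open>u'\<close> does not.\<close>
      have "{(s, t) \<in> H. (u, s) \<in> H\<^sup>* \<and> (t, b) \<in> H\<^sup>*} \<subseteq> ?T"
      proof clarify
        fix s t assume st: "(s, t) \<in> H" "(t, b) \<in> H\<^sup>*"
        then have "(s, b) \<in> H\<^sup>*" by auto
        then have "s \<noteq> u'" "t \<noteq> u'" using st nb by blast+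
        then show "(s, t) \<in> ?T" using st by auto
      qed
      then have "(u, b) \<in> ?T\<^sup>*"
        using rtrancl_restrict_interval[OF 1(3)] rtrancl_mono by blast
      also have "(b, v) \<in> ?T\<^sup>*" using up bv ub by blast
      also have "sym (?T\<^sup>*)" by (rule sym_rtrancl) (auto intro!: symI)
      then have "(v, u') \<in> ?T\<^sup>*"
        using up[of u' v] u' av by (meson r_into_trancl' rtrancl_trans symD)
      finally show ?thesis using all_bridgesD[OF br, of u u'] u' by auto
    qed
  qed (use 1 in auto)
qed

section \<open>Parallel paths in a vertebrate digraph\<close>

locale vertebrate_rel =
  fixes A :: "'a rel"
  assumes finite_A: "finite A" and acyclic_A: "acyclic A"
    and bridges: "\<And>W. all_bridges (covers (A \<inter> W \<times> W))"
begin

text \<open>\<open>Z\<close> has the same reachability as its covers, so the chain property of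
  forests carries over to induced subgraphs.\<close>

lemma interval_chain:
  assumes Z: "Z = A \<inter> W \<times> W"
    and "(u, a) \<in> Z\<^sup>*" "(u, b) \<in> Z\<^sup>*" "(a, v) \<in> Z\<^sup>*" "(b, v) \<in> Z\<^sup>*"
  shows "(a, b) \<in> Z\<^sup>* \<or> (b, a) \<in> Z\<^sup>*"
proof -
  have "finite Z" "acyclic Z" using finite_A acyclic_A Z by (auto intro: acyclic_subset)
  then have eq: "(covers Z)\<^sup>* = Z\<^sup>*" using trancl_covers by (metis rtrancl_trancl_reflcl)
  have "finite (covers Z)" "acyclic (covers Z)"
    using \<open>finite Z\<close> \<open>acyclic Z\<close> covers_subset by (auto intro: acyclic_subset finite_subset)
  then show ?thesis using all_bridges_interval_chain[of "covers Z" u a b v] bridges[of W] assms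
    unfolding eq by (simp add: eq)
qed

text \<open>Extends the hypothesis from single arcs of \<open>B\<close> to \<open>B\<close>-paths.
  The induction proceeds backwards from the sinks, so \<open>IH\<close> covers every source strictly
  after \<open>u\<close>.\<close>

lemma trancl_disjoint:
  assumes R: "R = A \<inter> B\<^sup>+" and BA: "B \<subseteq> A" and B: "B \<inter> (A - R)\<^sup>+ = {}"
  shows "B\<^sup>+ \<inter> (A - R)\<^sup>+ = {}"
proof -
  define Y where "Y = A - R"
  have False if "(u, v) \<in> B\<^sup>+" "(u, v) \<in> Y\<^sup>+" for u v
    using that
  proof (induction u rule: wf_induct_rule[OF wf_trancl[OF finite_acyclic_wf_converse[OF finite_A acyclic_A]]])
    case (1 u)
    note IH = 1(1)[unfolded trancl_converse converse_iff]
    have A_irr: "(x, x) \<notin> A\<^sup>+" for x using acyclic_A by (auto simp: acyclic_def)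
    have YA: "Y \<subseteq> A" by (auto simp: Y_def)
    have BA': "B\<^sup>+ \<subseteq> A\<^sup>+" "B\<^sup>* \<subseteq> A\<^sup>*" and YA': "Y\<^sup>+ \<subseteq> A\<^sup>+" "Y\<^sup>* \<subseteq> A\<^sup>*"
      using BA YA by (auto intro: trancl_mono rtrancl_mono[THEN subsetD])
    obtain a where a: "(u, a) \<in> B" "(a, v) \<in> B\<^sup>*" using 1(2) by (meson tranclD)
    obtain b where b: "(u, b) \<in> Y" "(b, v) \<in> Y\<^sup>*" using 1(3) by (meson tranclD)
    \<comment> \<open>The induced subgraph \<open>Z\<close> is to contain a path from
      \<open>a\<close> and one from \<open>b\<close> to \<open>v\<close>, while each of its vertices
      other than \<open>u\<close> stays attributable to \<open>B\<close> or to
      \<open>Y\<close>.\<close>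
    define P where "P = {x. (a, x) \<in> B\<^sup>* \<and> (x, v) \<in> B\<^sup>*}"
    define Q where "Q = {x. (b, x) \<in> Y\<^sup>* \<and> (x, v) \<in> Y\<^sup>*}"
    define W where "W = insert u (P \<union> Q)"
    define Z where "Z = A \<inter> W \<times> W"
    have ZA: "Z\<^sup>* \<subseteq> A\<^sup>*" unfolding Z_def by (rule rtrancl_mono) auto
    have "{(s, t) \<in> B. (a, s) \<in> B\<^sup>* \<and> (t, v) \<in> B\<^sup>*} \<subseteq> Z"
      using BA by (auto simp: Z_def W_def P_def intro: rtrancl_into_rtrancl converse_rtrancl_into_rtrancl)
    then have av: "(a, v) \<in> Z\<^sup>*" using rtrancl_restrict_interval[OF a(2)] rtrancl_mono by blast
    have "{(s, t) \<in> Y. (b, s) \<in> Y\<^sup>* \<and> (t, v) \<in> Y\<^sup>*} \<subseteq> Z"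
      using YA by (auto simp: Z_def W_def Q_def intro: rtrancl_into_rtrancl converse_rtrancl_into_rtrancl)
    then have bv: "(b, v) \<in> Z\<^sup>*" using rtrancl_restrict_interval[OF b(2)] rtrancl_mono by blast
    have ua: "(u, a) \<in> Z" and ub: "(u, b) \<in> Z"
      using a b BA YA by (auto simp: Z_def W_def P_def Q_def)
    have "a \<noteq> b" using a b B unfolding Y_def by blast
    have uA: "(u, a) \<in> A" "(u, b) \<in> A" using ua ub by (auto simp: Z_def)
    consider "(a, b) \<in> Z\<^sup>+" | "(b, a) \<in> Z\<^sup>+"
      using interval_chain[OF Z_def r_into_rtrancl[OF ua] r_into_rtrancl[OF ub] av bv] \<open>a \<noteq> b\<close>
      by (auto simp: rtrancl_eq_or_trancl)
    then show False
    proof cases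
      case 1
      \<comment> \<open>\<open>p\<close> is the predecessor of \<open>b\<close> on a path in
        \<open>Z\<close>. Acyclicity excludes \<open>u\<close> and \<open>Q\<close>, so the arc from
        \<open>p\<close> to \<open>b\<close> switches from the \<open>B\<close>-side to the
        \<open>Y\<close>-side.\<close>
      then obtain p where p: "(a, p) \<in> Z\<^sup>*" "(p, b) \<in> Z" by (meson tranclD2)
      have up: "(u, p) \<in> A\<^sup>+" using uA p ZA by (meson rtrancl_into_trancl2 subsetD)
      have "p \<in> W" and pbA: "(p, b) \<in> A" using p by (auto simp: Z_def)
      moreover have "p \<noteq> u" using up A_irr by blast
      moreover have "p \<notin> Q"
        using pbA YA' A_irr unfolding Q_def by (metis (no_types, lifting) mem_Collect_eq rtrancl_into_trancl2 subsetD)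
      ultimately have "p \<in> P" by (auto simp: W_def)
      then have ap: "(a, p) \<in> B\<^sup>*" and pv: "(p, v) \<in> B\<^sup>*" by (auto simp: P_def)
      have "p \<noteq> v" using b(2) pbA YA' A_irr
        by (metis rtrancl_into_trancl2 subsetD)
      then have pv: "(p, v) \<in> B\<^sup>+" using pv by (meson rtranclD)
      \<comment> \<open>If the switch lies in \<open>Y\<close>, there is a parallel pair with the
        later source \<open>p\<close>; if it lies in \<open>R\<close>, then \<open>(u, b)\<close>
        lies in \<open>R\<close> as well, although it was taken from \<open>Y\<close>.\<close>
      show False
      proof (cases "(p, b) \<in> Y")
        case True
        then have "(p, v) \<in> Y\<^sup>+" using b by auto
        then show False using IH[OF up] pv by blast
      next
        case False
        then have "(p, b) \<in> B\<^sup>+" using pbA by (auto simp: Y_def R)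
        moreover have "(u, p) \<in> B\<^sup>+" using a ap by auto
        ultimately have "(u, b) \<in> B\<^sup>+" by auto
        then show False using b uA by (auto simp: Y_def R)
      qed
    next
      case 2
      then obtain p where p: "(b, p) \<in> Z\<^sup>*" "(p, a) \<in> Z" by (meson tranclD2)
      have up: "(u, p) \<in> A\<^sup>+" using uA p ZA by (meson rtrancl_into_trancl2 subsetD)
      have "p \<in> W" and paA: "(p, a) \<in> A" using p by (auto simp: Z_def)
      moreover have "p \<noteq> u" using up A_irr by blast
      moreover have "p \<notin> P"
        using paA BA' A_irr unfolding P_def by (metis (no_types, lifting) mem_Collect_eq rtrancl_into_trancl2 subsetD)
      ultimately have "p \<in> Q" by (auto simp: W_def)
      then have bp: "(b, p) \<in> Y\<^sup>*" and pv: "(p, v) \<in> Y\<^sup>*" by (auto simp: Q_def)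
      have "p \<noteq> v" using a(2) paA BA' A_irr
        by (metis rtrancl_into_trancl2 subsetD)
      then have pv: "(p, v) \<in> Y\<^sup>+" using pv by (meson rtranclD)
      \<comment> \<open>Now a switch in \<open>Y\<close> gives a \<open>Y\<close>-path parallel to
        the arc \<open>(u, a)\<close> of \<open>B\<close>, against the hypothesis, and a switch in
        \<open>R\<close> gives the pair with later source.\<close>
      show False
      proof (cases "(p, a) \<in> Y")
        case True
        then have "(u, a) \<in> Y\<^sup>+" using b bp by (meson rtrancl_into_trancl1 rtrancl_into_trancl2 rtrancl_trancl_trancl trancl_into_trancl)
        then show False using a B by (auto simp: Y_def)
      next
        case False
        then have "(p, a) \<in> B\<^sup>+" using paA by (auto simp: Y_def R)
        then have "(p, v) \<in> B\<^sup>+" using a by auto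
        then show False using IH[OF up] pv by blast
      qed
    qed
  qed
  then show ?thesis by (auto simp: Y_def)
qed

end

section \<open>Cycles in reorientations\<close>

text \<open>If this arc were missing, the closing arc from \<open>f (n - 1)\<close> to
  \<open>f 0\<close> would be the only arc of \<open>Z\<close> leaving the vertices of index above
  \<open>j\<close>. By acyclicity a longer path parallel to the closing arc cannot use it, so it
  would never reach \<open>f 0\<close>.\<close>

lemma chordless_cycle_path:
  assumes ac: "acyclic Z" and inj: "inj_on f {..<n}" and Z: "Z \<subseteq> f ` {..<n} \<times> f ` {..<n}"
    and chord: "\<And>i l. l < i \<Longrightarrow> i < n \<Longrightarrow> (f i, f l) \<in> Z \<or> (f l, f i) \<in> Z \<Longrightarrow>
      i = Suc l \<or> l = 0 \<and> i = n - 1"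
    and long: "(f (n - 1), f 0) \<in> Z O Z\<^sup>+" and j: "Suc j < n"
  shows "(f (Suc j), f j) \<in> Z"
proof (rule ccontr)
  assume no: "(f (Suc j), f j) \<notin> Z"
  let ?C = "f ` {Suc j..<n}"
  have irr: "(x, x) \<notin> Z\<^sup>+" for x using ac by (auto simp: acyclic_def)
  have closed: "y \<in> ?C" if xy: "(x, y) \<in> Z" "x \<in> ?C" "(x, y) \<noteq> (f (n - 1), f 0)" for x y
  proof (rule ccontr)
    assume y: "y \<notin> ?C"
    obtain i where i: "x = f i" "j < i" "i < n" using xy(2) by auto
    obtain l where l: "y = f l" "l < n" using Z xy(1) by auto
    then have "l \<le> j" using y by (cases "l \<le> j") auto
    then have "i = Suc l \<or> l = 0 \<and> i = n - 1" using chord[of l i] i l xy(1) by auto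
    then show False
    proof
      assume "i = Suc l"
      then have "l = j" using i \<open>l \<le> j\<close> by auto
      then show False using no xy(1) i l \<open>i = Suc l\<close> by auto
    qed (use xy(3) i l in auto)
  qed
  obtain w where w: "(f (n - 1), w) \<in> Z" "(w, f 0) \<in> Z\<^sup>+" using long by auto
  have "w \<noteq> f 0" using w irr by metis
  have "w \<in> ?C" using closed[OF w(1)] \<open>w \<noteq> f 0\<close> j by auto
  \<comment> \<open>The second conjunct records that the current vertex lies after
    \<open>f (n - 1)\<close>, hence differs from it, so the closing arc is never the next
    step.\<close>
  have "f 0 \<in> ?C \<and> (f (n - 1), f 0) \<in> Z\<^sup>+" using w(2)
  proof (induction rule: trancl_induct)
    case (base y)
    have "w \<noteq> f (n - 1)" using w(1) irr by blast
    then show ?case using closed[OF base] \<open>w \<in> ?C\<close> w(1) base by auto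
  next
    case (step y z)
    then have "y \<noteq> f (n - 1)" using irr by blast
    then show ?case using step closed[of y z] by auto
  qed
  then obtain i where "f 0 = f i" "i < n" "0 < i" by auto
  then show False using inj by (auto simp: inj_on_def)
qed

text \<open>If every edge of the cycle were a cover or a reversed cover, then deleting one of them would
  leave a path between its end points, contrary to its being a bridge.\<close>
lemma (in vertebrate_rel) acyclic_reversal:
  assumes RA: "R \<subseteq> A" and R: "R \<inter> (A - R)\<^sup>+ = {}" and co: "(A - R) \<inter> R\<^sup>+ = {}"
  shows "acyclic ((A - R) \<union> R\<inverse>)"
proof (rule ccontr)
  define N where "N = (A - R) \<union> R\<inverse>"
  define cyc_len where "cyc_len = (\<lambda>n. 0 < n \<and> (\<exists>x. (x, x) \<in> N ^^ n))"
  assume "\<not> acyclic ((A - R) \<union> R\<inverse>)"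
  then have ex: "\<exists>n. cyc_len n"
    by (auto simp: acyclic_def N_def[symmetric] trancl_power cyc_len_def)
  define n where "n = (LEAST n. cyc_len n)"
  have n: "0 < n" "\<exists>x. (x, x) \<in> N ^^ n"
    using LeastI_ex[OF ex] unfolding n_def by (auto simp: cyc_len_def)
  have least: "n \<le> k" if "0 < k" "(x, x) \<in> N ^^ k" for k x
    unfolding n_def by (rule Least_le) (use that in \<open>auto simp: cyc_len_def\<close>)
  from n(2) obtain f where f: "f 0 = f n" "\<And>i. i < n \<Longrightarrow> (f i, f (Suc i)) \<in> N"
    unfolding relpow_fun_conv by metis
  have irr: "(x, x) \<notin> A\<^sup>+" for x using acyclic_A by (auto simp: acyclic_def)
  have A_asym: "(y, x) \<notin> A" if "(x, y) \<in> A" for x y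
    using irr[of x] that by (auto dest: trancl_trans[OF r_into_trancl r_into_trancl])
  have N_A: "N \<subseteq> A \<union> A\<inverse>" "A \<subseteq> N \<union> N\<inverse>" using RA by (auto simp: N_def)
  have N_irr: "(x, x) \<notin> N" for x using N_A irr by blast
  have N_asym: "(y, x) \<notin> N" if "(x, y) \<in> N" for x y
    using that A_asym RA unfolding N_def by blast
  have n3: "3 \<le> n"
  proof (rule ccontr)
    assume "\<not> 3 \<le> n"
    then have "n = 1 \<or> n = 2" using n by auto
    then show False
      using f(1) f(2)[of 0] f(2)[of 1] N_irr N_asym by (auto simp: numeral_2_eq_2)
  qed
  \<comment> \<open>Stated for every closed walk \<open>g\<close> of minimal length, because it is
    applied to \<open>f\<close> and to its rotations.\<close>
  have cyc: "inj_on g {..<n}"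
    "\<And>i l. l < i \<Longrightarrow> i < n \<Longrightarrow> (g i, g l) \<in> A \<or> (g l, g i) \<in> A \<Longrightarrow> i = Suc l \<or> l = 0 \<and> i = n - 1"
    if g: "g 0 = g n" "\<And>i. i < n \<Longrightarrow> (g i, g (Suc i)) \<in> N" for g
  proof -
    have walk: "(g i, g j) \<in> N ^^ (j - i)" if "i \<le> j" "j \<le> n" for i j
      unfolding relpow_fun_conv
      by (rule exI[of _ "\<lambda>k. g (i + k)"]) (use that g(2) in auto)
    show "inj_on g {..<n}"
    proof (rule linorder_inj_onI')
      fix i j assume "i \<in> {..<n}" "j \<in> {..<n}" "i < j"
      then show "g i \<noteq> g j" using walk[of i j] least[of "j - i" "g i"] by force
    qed
    show "i = Suc l \<or> l = 0 \<and> i = n - 1"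
      if li: "l < i" "i < n" and A: "(g i, g l) \<in> A \<or> (g l, g i) \<in> A" for i l
    proof -
      \<comment> \<open>A backward chord yields a closed walk of length \<open>i - l + 1\<close>, a
        forward chord one of length \<open>n - (i - l) + 1\<close>; minimality of \<open>n\<close>
        leaves only the edges of the cycle.\<close>
      have "(g i, g l) \<in> N \<or> (g l, g i) \<in> N" using A N_A by blast
      then show ?thesis
      proof
        assume "(g i, g l) \<in> N"
        then have w: "(g l, g l) \<in> N ^^ Suc (i - l)" using walk[of l i] li by auto
        show ?thesis using least[OF _ w] li by auto
      next
        assume "(g l, g i) \<in> N"
        then have "(g 0, g i) \<in> N ^^ Suc l" using walk[of 0 l] li by auto
        moreover have "(g i, g 0) \<in> N ^^ (n - i)" using walk[of i n] li g(1) by auto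
        ultimately have w: "(g 0, g 0) \<in> N ^^ (Suc l + (n - i))" unfolding relpow_add by blast
        show ?thesis using least[OF _ w] li by auto
      qed
    qed
  qed
  define W where "W = f ` {..<n}"
  define Z where "Z = A \<inter> W \<times> W"
  define H where "H = covers Z"
  have Z_ac: "acyclic Z" using acyclic_A by (auto simp: Z_def intro: acyclic_subset)
  \<comment> \<open>If the closing edge is no cover, the other edges form in \<open>A\<close> a
    directed path parallel to it and oppositely reoriented.\<close>
  have last: "(g (n - 1), g 0) \<in> H \<union> H\<inverse>"
    if g: "g 0 = g n" "\<And>i. i < n \<Longrightarrow> (g i, g (Suc i)) \<in> N" and W: "W = g ` {..<n}" for g
  proof (rule ccontr)
    assume no: "(g (n - 1), g 0) \<notin> H \<union> H\<inverse>"
    note inj = cyc(1)[of g, OF g] and chord = cyc(2)[of g, OF g]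
    have ZW: "Z \<subseteq> g ` {..<n} \<times> g ` {..<n}" by (auto simp: Z_def W)
    have inW: "g (n - 1) \<in> W" "g 0 \<in> W" using n W by auto
    have edge: "(g (n - 1), g 0) \<in> N" using g(1) g(2)[of "n - 1"] n by auto
    then consider "(g (n - 1), g 0) \<in> A - R" | "(g 0, g (n - 1)) \<in> R" by (auto simp: N_def)
    then show False
    proof cases
      case 1
      then have "(g (n - 1), g 0) \<in> Z O Z\<^sup>+" using no inW by (auto simp: Z_def H_def covers_def)
      note long = this
      have "(g (Suc j), g j) \<in> Z" if "Suc j < n" for j
        by (rule chordless_cycle_path[OF Z_ac inj ZW _ long that])
          (use chord in \<open>auto simp: Z_def\<close>)
      then have st: "(g (Suc j), g j) \<in> R" if "Suc j < n" for j
        using that g(2)[of j] A_asym unfolding N_def Z_def by auto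
      have "(g j, g 0) \<in> R\<^sup>*" if "j < n" for j
        using that by (induction j) (auto intro: converse_rtrancl_into_rtrancl st)
      then have "(g (n - 1), g 0) \<in> R\<^sup>*" using n by auto
      moreover have "g (n - 1) \<noteq> g 0" using edge N_irr by metis
      ultimately have "(g (n - 1), g 0) \<in> R\<^sup>+" by (simp add: rtrancl_eq_or_trancl)
      then show False using 1 co by auto
    next
      case 2
      then have "(g 0, g (n - 1)) \<in> Z O Z\<^sup>+" using no inW RA by (auto simp: Z_def H_def covers_def)
      \<comment> \<open>With the single step moved to the end, the converse again starts with a
        single step, as needed to use \<open>chordless_cycle_path\<close> for
        \<open>Z\<inverse>\<close>.\<close>
      then have "(g 0, g (n - 1)) \<in> Z\<^sup>+ O Z"
        by (metis trancl_unfold_right O_assoc r_comp_rtrancl_eq)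
      then have "(g (n - 1), g 0) \<in> Z\<inverse> O (Z\<inverse>)\<^sup>+" by (auto simp: trancl_converse)
      note long = this
      have conv: "acyclic (Z\<inverse>)" "Z\<inverse> \<subseteq> g ` {..<n} \<times> g ` {..<n}" using Z_ac ZW by auto
      have "(g (Suc j), g j) \<in> Z\<inverse>" if "Suc j < n" for j
        by (rule chordless_cycle_path[OF conv(1) inj conv(2) _ long that])
          (use chord in \<open>auto simp: Z_def\<close>)
      then have st: "(g j, g (Suc j)) \<in> A - R" if "Suc j < n" for j
        using that g(2)[of j] A_asym RA unfolding N_def Z_def by auto
      have "(g 0, g j) \<in> (A - R)\<^sup>*" if "j < n" for j
        using that 
      proof (induction j)
        case (Suc j)
        then show ?case using rtrancl_into_rtrancl[OF _ st] by simp
      qed simp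
      then have "(g 0, g (n - 1)) \<in> (A - R)\<^sup>*" using n by auto
      moreover have "g (n - 1) \<noteq> g 0" using edge N_irr by metis
      ultimately have "(g 0, g (n - 1)) \<in> (A - R)\<^sup>+" by (simp add: rtrancl_eq_or_trancl)
      then show False using 2 R by auto
    qed
  qed
  have edges: "(f i, f (Suc i)) \<in> H \<union> H\<inverse>" if "i < n" for i
  proof -
    \<comment> \<open>This rotation turns the edge from \<open>f i\<close> to
      \<open>f (Suc i)\<close> into the closing edge.\<close>
    let ?g = "\<lambda>j. f ((j + Suc i) mod n)"
    have f_mod: "f (Suc m mod n) = f (Suc (m mod n))" for m
      using f(1) by (simp add: mod_Suc)
    have "{..<n} \<subseteq> (\<lambda>j. (j + Suc i) mod n) ` {..<n}"
    proof
      fix k assume "k \<in> {..<n}"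
      then have "((k + (n - Suc i)) mod n + Suc i) mod n = k"
        using that unfolding mod_add_left_eq by simp
      then show "k \<in> (\<lambda>j. (j + Suc i) mod n) ` {..<n}"
        using n by (intro image_eqI[of _ _ "(k + (n - Suc i)) mod n"]) auto
    qed
    then have "(\<lambda>j. (j + Suc i) mod n) ` {..<n} = {..<n}" using n by auto
    then have "W = ?g ` {..<n}" unfolding W_def by (metis image_image)
    moreover have "(?g j, ?g (Suc j)) \<in> N" for j
      using f(2)[of "(j + Suc i) mod n"] f_mod[of "j + Suc i"] n by simp
    moreover have "?g 0 = ?g n" by (simp only: mod_add_self1 add_0)
    ultimately have "(?g (n - 1), ?g 0) \<in> H \<union> H\<inverse>" using last[of ?g] by blast
    moreover have "?g (n - 1) = f i" using that by simp
    moreover have "?g 0 = f (Suc i)" using f_mod[of i] that by simp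
    ultimately show ?thesis by simp
  qed
  let ?T = "H \<union> H\<inverse> - {(f (n - 1), f 0), (f 0, f (n - 1))}"
  have inj: "inj_on f {..<n}" by (rule cyc(1)[of f, OF f])
  have T: "(f i, f (Suc i)) \<in> ?T" if "Suc i < n" for i
  proof -
    have "f i = f 0 \<longleftrightarrow> i = 0" "f (Suc i) \<noteq> f 0" "f i \<noteq> f (n - 1)"
      "f (Suc i) = f (n - 1) \<longleftrightarrow> Suc i = n - 1"
      using inj_on_eq_iff[OF inj] that by auto
    \<comment> \<open>In a cycle of length 2 the edge from \<open>f 0\<close> to \<open>f 1\<close>
      would be the deleted closing edge.\<close>
    moreover have "\<not> (i = 0 \<and> Suc i = n - 1)" using n3 by auto
    ultimately have "(f i, f (Suc i)) \<notin> {(f (n - 1), f 0), (f 0, f (n - 1))}"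
      unfolding insert_iff prod.inject by blast
    then show ?thesis using edges[of i] that by (meson DiffI Suc_lessD)
  qed
  have "(f 0, f j) \<in> ?T\<^sup>*" if "j < n" for j
    using that
  proof (induction j)
    case (Suc j)
    then show ?case using rtrancl_into_rtrancl[OF _ T] Suc_lessD by blast
  qed simp
  then have "(f 0, f (n - 1)) \<in> ?T\<^sup>*" using n by auto
  moreover have "(f 0, f (n - 1)) \<in> H \<union> H\<inverse>" using edges[of "n - 1"] f(1) n by (auto simp del: One_nat_def)
  ultimately show False
    using all_bridgesD[of H "f 0" "f (n - 1)"] bridges[of W]
    by (simp add: H_def Z_def insert_commute)
qed

section \<open>From digraphs to arc relations\<close>

lemma (in pre_digraph) cas_trancl:
  assumes "cas u p v" "p \<noteq> []" "set p \<subseteq> arcs G"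
  shows "(u, v) \<in> (arcs_ends G)\<^sup>+"
  using assms
proof (induction p arbitrary: u)
  case (Cons e p)
  have e: "(u, head G e) \<in> arcs_ends G"
    using Cons.prems by (auto simp: arcs_ends_def arc_to_ends_def)
  show ?case
  proof (cases "p = []")
    case False
    then show ?thesis using Cons e by (auto intro: trancl_into_trancl2)
  qed (use Cons.prems e in auto)
qed simp

text \<open>The end points of an edge that is no bridge are joined by a simple path avoiding it.
  Such a path has at least two arcs, so appending \<open>(y, x)\<close> closes a cycle of length at
  least 3.\<close>

lemma undirected_forest_all_bridges:
  assumes G: "wf_digraph G" and fin: "undirected_forest G" and H: "H \<subseteq> arcs_ends G"
    and irr: "irrefl H"
  shows "all_bridges H"
proof (rule ccontr)
  assume "\<not> all_bridges H"
  then obtain x y where xy: "(x, y) \<in> H"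
    and path: "(x, y) \<in> (H \<union> H\<inverse> - {(x, y), (y, x)})\<^sup>*"
    by (auto simp: all_bridges_def)
  define K where "K = \<lparr>pverts = verts G, parcs = H \<union> H\<inverse> - {(x, y), (y, x)}\<rparr>"
  interpret G: wf_digraph G by (rule G)
  have HV: "H \<subseteq> verts G \<times> verts G" using H G.adj_in_verts by auto
  interpret K: pair_wf_digraph K
    by unfold_locales (use HV in \<open>auto simp: K_def\<close>)
  interpret S: pair_wf_digraph "mk_symmetric G" by (rule G.wellformed_mk_symmetric)
  have HS: "H \<union> H\<inverse> \<subseteq> parcs (mk_symmetric G)"
    using H by (force simp: parcs_mk_symmetric arcs_ends_def arc_to_ends_def)
  have "x \<noteq> y" using xy irr by (auto simp: irrefl_def)
  have "x \<rightarrow>\<^sup>*\<^bsub>K\<^esub> y"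
    using path \<open>x \<noteq> y\<close> K.reachable1_reachable[of x y] by (simp add: K_def rtrancl_eq_or_trancl)
  then obtain p where "K.apath x p y" by (auto simp: K.reachable_apath)
  then have p: "set p \<subseteq> parcs K" "pcas x p y" "distinct (pawalk_verts x p)"
    by (auto simp: K.apath_def K.awalk_def)
  have sub: "set p \<subseteq> parcs (mk_symmetric G)" using p(1) HS by (auto simp: K_def)
  have len: "2 \<le> length p"
  proof (rule ccontr)
    assume "\<not> 2 \<le> length p"
    then have "p = [] \<or> (\<exists>e. p = [e])" by (cases p; cases "tl p") auto
    then show False using p \<open>x \<noteq> y\<close> by (auto simp: K_def)
  qed
  have "pcas z p y \<Longrightarrow> pawalk_verts z (p @ [(y, x)]) = pawalk_verts z p @ [x] \<and> pcas z (p @ [(y, x)]) x"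
    for z by (induction p arbitrary: z) auto
  note snoc = this[OF p(2)]
  have "(y, x) \<in> parcs (mk_symmetric G)" using xy HS by auto
  then have "S.awalk x (p @ [(y, x)]) x"
    using snoc sub S.in_arcsD2 by (auto simp: S.awalk_def)
  moreover have "distinct (tl (pawalk_verts x (p @ [(y, x)])))"
    using snoc p(2,3) by (cases p) auto
  ultimately have "S.cycle (p @ [(y, x)])" by (auto simp: S.cycle_def)
  then show False using fin len by (auto simp: undirected_forest_def)
qed

text \<open>A simple path of length at least 2 puts its end points into
  \<open>Z O Z\<^sup>+\<close>, so covers survive in the transitive reduction and its forest
  property makes them bridges.\<close>

lemma pair_digraph_vertebrate_rel:
  assumes "pair_digraph D" "acyclic (parcs D)" "vertebrate D"
  shows "vertebrate_rel (parcs D)"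
proof -
  interpret D: pair_digraph D by fact
  show ?thesis
  proof
    show "finite (parcs D)" by (rule D.pair_finite_arcs)
    show "acyclic (parcs D)" by fact
    fix W
    define G where "G = with_proj D \<restriction> (W \<inter> pverts D)"
    define Z where "Z = parcs D \<inter> W \<times> W"
    have arcs: "arcs G = Z" "tail G = fst" "head G = snd"
      using D.in_arcsD1 D.in_arcsD2 by (auto simp: G_def Z_def induce_subgraph_def)
    have verts: "verts G = W \<inter> pverts D" by (simp add: G_def)
    have ends: "arcs_ends G = Z" by (auto simp: arcs_ends_def arc_to_ends_def arcs)
    have "covers Z \<subseteq> arcs (transitive_reduction G)"
    proof clarify
      fix u v assume uv: "(u, v) \<in> covers Z"
      have False if p: "pre_digraph.apath G u p v" "2 \<le> length p" for p
      proof -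
        obtain e es where es: "p = e # es" "es \<noteq> []" using p(2) by (cases p; cases "tl p") auto
        then have "e \<in> Z" "fst e = u" "(snd e, v) \<in> Z\<^sup>+"
          using p(1) pre_digraph.cas_trancl[of G "snd e" es v]
          by (auto simp: pre_digraph.apath_def pre_digraph.awalk_def pre_digraph.cas.simps arcs ends)
        then show False using uv by (cases e) (auto simp: covers_def)
      qed
      then show "(u, v) \<in> arcs (transitive_reduction G)"
        using uv covers_subset by (auto simp: transitive_reduction_def arcs)
    qed
    then have "covers Z \<subseteq> arcs_ends (transitive_reduction G)"
      by (force simp: arcs_ends_def arc_to_ends_def transitive_reduction_def arcs)
    moreover have "undirected_forest (transitive_reduction G)"
      using assms(3) by (auto simp: vertebrate_def G_def)
    moreover have "irrefl (covers Z)"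
      using assms(2) by (auto simp: irrefl_def covers_def Z_def acyclic_def)
    moreover have "wf_digraph (transitive_reduction G)"
      by unfold_locales
        (auto simp: transitive_reduction_def arcs verts Z_def D.in_arcsD1 D.in_arcsD2)
    ultimately show "all_bridges (covers (parcs D \<inter> W \<times> W))"
      using undirected_forest_all_bridges by (auto simp: Z_def)
  qed
qed

section \<open>Joins and meets of acyclic reorientations\<close>

text \<open>Reversing exactly one of two parallel paths would create a directed cycle.\<close>

lemma acyclic_reorientation_disjoint:
  assumes "R \<in> acyclic_reorientations D"
  shows "R\<^sup>+ \<inter> (parcs D - R)\<^sup>+ = {}"
proof -
  let ?N = "parcs D - R \<union> R\<inverse>"
  have ac: "acyclic ?N" using assms by (simp add: acyclic_reorientations_def reorient_def)
  have "False" if "(u, v) \<in> R\<^sup>+" "(u, v) \<in> (parcs D - R)\<^sup>+" for u v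
  proof -
    have "(v, u) \<in> (R\<inverse>)\<^sup>+" using that by (simp add: trancl_converse)
    then have "(v, u) \<in> ?N\<^sup>+" by (rule trancl_mono) auto
    moreover have "(u, v) \<in> ?N\<^sup>+" using that(2) by (rule trancl_mono) auto
    ultimately have "(u, u) \<in> ?N\<^sup>+" by (rule trancl_trans[rotated])
    then show False using ac by (auto simp: acyclic_def)
  qed
  then show ?thesis by auto
qed

lemma acyclic_reorientation_diff:
  assumes "R \<in> acyclic_reorientations D"
  shows "parcs D - R \<in> acyclic_reorientations D"
proof -
  have "parcs D - (parcs D - R) \<union> (parcs D - R)\<inverse> = (parcs D - R \<union> R\<inverse>)\<inverse>"
    using assms by (auto simp: acyclic_reorientations_def)
  then show ?thesis using assms
    by (simp add: acyclic_reorientations_def reorient_def)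
qed

text \<open>Arcs outside \<open>R\<close> lie outside every member of \<open>\<E>\<close>, so a path
  of them is parallel to no arc of a member. \<open>trancl_disjoint\<close> extends this to paths,
  which gives the closedness needed for \<open>acyclic_reversal\<close>.\<close>

lemma acyclic_reorientations_join:
  assumes "vertebrate_rel (parcs D)" and E: "\<E> \<subseteq> acyclic_reorientations D"
  shows "parcs D \<inter> (\<Union>\<E>)\<^sup>+ \<in> acyclic_reorientations D"
proof -
  interpret vertebrate_rel "parcs D" by fact
  define R where "R = parcs D \<inter> (\<Union>\<E>)\<^sup>+"
  have sub: "\<Union>\<E> \<subseteq> parcs D" using E by (auto simp: acyclic_reorientations_def)
  have "\<Union>\<E> \<inter> (parcs D - R)\<^sup>+ = {}"
  proof -
    have False if "(u, v) \<in> F" "F \<in> \<E>" "(u, v) \<in> (parcs D - R)\<^sup>+" for u v F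
    proof -
      have "parcs D - R \<subseteq> parcs D - F" using that(2) by (auto simp: R_def)
      then have "(u, v) \<in> (parcs D - F)\<^sup>+" using that(3) trancl_mono by blast
      then show False using acyclic_reorientation_disjoint[of F D] that E by blast
    qed
    then show ?thesis by auto
  qed
  then have disj: "(\<Union>\<E>)\<^sup>+ \<inter> (parcs D - R)\<^sup>+ = {}"
    by (intro trancl_disjoint[OF R_def sub])
  have R_sub: "R \<subseteq> (\<Union>\<E>)\<^sup>+" "R \<subseteq> parcs D" by (simp_all add: R_def)
  then have "R\<^sup>+ \<subseteq> (\<Union>\<E>)\<^sup>+"
    using trancl_mono_subset[OF R_sub(1)] by simp
  then have "(parcs D - R) \<inter> R\<^sup>+ = {}" unfolding R_def by blast
  moreover have "R \<inter> (parcs D - R)\<^sup>+ = {}" using disj R_sub(1) by blast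
  ultimately have "R \<in> acyclic_reorientations D"
    using acyclic_reversal[of R] R_sub(2) by (simp add: acyclic_reorientations_def reorient_def)
  then show ?thesis by (simp add: R_def)
qed

text \<open>An arc outside \<open>F\<close> cannot be parallel to a path in
  \<open>F\<close>.\<close>

lemma acyclic_reorientation_join_least:
  assumes "F \<in> acyclic_reorientations D" "B \<subseteq> F"
  shows "parcs D \<inter> B\<^sup>+ \<subseteq> F"
proof (rule subrelI, rule ccontr)
  fix u v assume uv: "(u, v) \<in> parcs D \<inter> B\<^sup>+" "(u, v) \<notin> F"
  then have "(u, v) \<in> F\<^sup>+" using trancl_mono_subset[OF assms(2)] by auto
  moreover have "(u, v) \<in> (parcs D - F)\<^sup>+" using uv by auto
  ultimately show False using acyclic_reorientation_disjoint[OF assms(1)] by auto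
qed

lemma AR_is_lubI:
  assumes "\<E> \<subseteq> carrier (AR D)" "J \<in> acyclic_reorientations D" "\<And>E. E \<in> \<E> \<Longrightarrow> E \<subseteq> J"
    and "\<And>F. F \<in> acyclic_reorientations D \<Longrightarrow> (\<And>E. E \<in> \<E> \<Longrightarrow> E \<subseteq> F) \<Longrightarrow> J \<subseteq> F"
  shows "is_lub (AR D) J \<E>"
proof -
  have "J \<subseteq> F" if "F \<in> Upper (AR D) \<E>" for F
    using that assms(1) by (intro assms(4)) (auto simp: Upper_def AR_def)
  then show ?thesis using assms(2,3) by (auto simp: least_def Upper_def AR_def)
qed

lemma AR_is_glbI:
  assumes "\<E> \<subseteq> carrier (AR D)" "J \<in> acyclic_reorientations D" "\<And>E. E \<in> \<E> \<Longrightarrow> J \<subseteq> E"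
    and "\<And>F. F \<in> acyclic_reorientations D \<Longrightarrow> (\<And>E. E \<in> \<E> \<Longrightarrow> F \<subseteq> E) \<Longrightarrow> F \<subseteq> J"
  shows "is_glb (AR D) J \<E>"
proof -
  have "F \<subseteq> J" if "F \<in> Lower (AR D) \<E>" for F
    using that assms(1) by (intro assms(4)) (auto simp: Lower_def AR_def)
  then show ?thesis using assms(2,3) by (auto simp: greatest_def Lower_def AR_def)
qed

lemma AR_is_lub:
  assumes "vertebrate_rel (parcs D)" and E: "\<E> \<subseteq> carrier (AR D)"
  shows "is_lub (AR D) (parcs D \<inter> (\<Union>\<E>)\<^sup>+) \<E>"
proof (rule AR_is_lubI[OF E])
  show "F \<subseteq> parcs D \<inter> (\<Union>\<E>)\<^sup>+" if "F \<in> \<E>" for F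
    using that E by (auto simp: AR_def acyclic_reorientations_def)
  show "parcs D \<inter> (\<Union>\<E>)\<^sup>+ \<subseteq> F"
    if "F \<in> acyclic_reorientations D" "\<And>E. E \<in> \<E> \<Longrightarrow> E \<subseteq> F" for F
    using that acyclic_reorientation_join_least[of F D "\<Union>\<E>"] by blast
  show "parcs D \<inter> (\<Union>\<E>)\<^sup>+ \<in> acyclic_reorientations D"
    using acyclic_reorientations_join[OF assms(1)] E by (simp add: AR_def)
qed

lemma AR_is_glb:
  assumes "vertebrate_rel (parcs D)" and E: "\<E> \<subseteq> carrier (AR D)"
  shows "is_glb (AR D) (parcs D - (\<Union>E\<in>\<E>. parcs D - E)\<^sup>+) \<E>"
proof -
  define A where "A = parcs D"
  let ?C = "(\<lambda>E. A - E) ` \<E>"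
  have C: "?C \<subseteq> acyclic_reorientations D"
    using E acyclic_reorientation_diff by (auto simp: AR_def A_def)
  \<comment> \<open>Exhibits the meet as the complement of the join of the complements.\<close>
  have eq: "A - (\<Union>?C)\<^sup>+ = A - (A \<inter> (\<Union>?C)\<^sup>+)" by auto
  have "A - (\<Union>?C)\<^sup>+ \<in> acyclic_reorientations D"
    unfolding eq using acyclic_reorientation_diff acyclic_reorientations_join[OF assms(1) C]
    by (simp add: A_def)
  moreover have "A - (\<Union>?C)\<^sup>+ \<subseteq> F" if "F \<in> \<E>" for F using that by auto
  moreover have "F \<subseteq> A - (\<Union>?C)\<^sup>+"
    if F: "F \<in> acyclic_reorientations D" "\<And>E. E \<in> \<E> \<Longrightarrow> F \<subseteq> E" for F
  proof -
    have "A \<inter> (\<Union>?C)\<^sup>+ \<subseteq> A - F"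
      unfolding A_def
      by (rule acyclic_reorientation_join_least[OF acyclic_reorientation_diff[OF F(1)]])
        (use F(2) in blast)
    moreover have "F \<subseteq> A" using F(1) by (simp add: acyclic_reorientations_def A_def)
    ultimately show ?thesis by auto
  qed
  ultimately show ?thesis by (intro AR_is_glbI[OF E]) (simp_all add: A_def)
qed

theorem theorem9:
  fixes D :: "'a pair_pre_digraph"
  assumes "pair_digraph D"
    and "acyclic (parcs D)"
    and "vertebrate D"
  shows "lattice (AR D) \<and>
    (\<forall>\<E> \<subseteq> carrier (AR D).
       is_lub (AR D) (parcs D \<inter> (\<Union>E\<in>\<E>. E)\<^sup>+) \<E> \<and>
       is_glb (AR D) (parcs D - (\<Union>E\<in>\<E>. parcs D - E)\<^sup>+) \<E>)"
proof -
  have vert: "vertebrate_rel (parcs D)"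
    using assms by (rule pair_digraph_vertebrate_rel)
  have "partial_order (AR D)"
    by unfold_locales (auto simp: AR_def)
  then interpret partial_order "AR D" .
  have "lattice (AR D)"
  proof
    fix x y assume "x \<in> carrier (AR D)" "y \<in> carrier (AR D)"
    then show "\<exists>s. is_lub (AR D) s {x, y}" "\<exists>s. is_glb (AR D) s {x, y}"
      using AR_is_lub[OF vert, of "{x, y}"] AR_is_glb[OF vert, of "{x, y}"] by blast+
  qed
  then show ?thesis using AR_is_lub[OF vert] AR_is_glb[OF vert] by simp
qed

end
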